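(* Let $q$ be a prime power, let $n,\kappa\ge 1$, $r,t\ge 0$ be integers with $n-r-2\kappa\ge 1$, and let $u\le n$. Let $\boldsymbol{H}\in\mathbb{F}_q^{2\kappa\times n}$ be a matrix such that for every $2\kappa\times u$ submatrix $\boldsymbol{H}^{(u)}$ formed by $u$ columns of $\boldsymbol{H}$, the reduced row echelon form of $\boldsymbol{H}^{(u)}$ has the block staircase form with block lengths at most $\lfloor\frac{q-1}{2}\rfloor$ (defined in the context). Let $\mathcal{C}$ be an $[n,k,d]_q$ linear code with $k=n-r$ and $d\ge 2t+1$, having a $k\times n$ generator matrix $$\boldsymbol{G}=\begin{bmatrix}\boldsymbol{G}_1\\ \boldsymbol{H}\end{bmatrix},\qquad \boldsymbol{G}_1=\begin{bmatrix}\boldsymbol{0}_{(n-r-2\kappa)\times 2\kappa} & \boldsymbol{I}_{n-r-2\kappa} & \boldsymbol{P}\end{bmatrix},\quad \boldsymbol{P}\in\mathbb{F}_q^{(n-r-2\kappa)\times r}.$$ Consider the following coding scheme. Encoder: given a set $\phi\subseteq\{0,\dots,n-1\}$ with $|\phi|=u$ and a message $\boldsymbol{m}\in\mathbb{F}_q^{n-r-2\kappa}$, put $\boldsymbol{w}=\boldsymbol{m}\boldsymbol{G}_1$, find $\boldsymbol{z}\in\mathbb{F}_q^{2\kappa}$ such that $(\boldsymbol{w}+\boldsymbol{z}\boldsymbol{H})_i\in\mathbb{F}_q\setminus\{0,-1\}$ for all $i\in\phi$, and output $\boldsymbol{c}=\boldsymbol{w}+\boldsymbol{z}\boldsymbol{H}$.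 Decoder: given $\boldsymbol{y}=\boldsymbol{c}+\boldsymbol{e}$, decode $\boldsymbol{y}$ in $\mathcal{C}$ to the nearest codeword $\hat{\boldsymbol{c}}$, and output the unique $\hat{\boldsymbol{m}}$ with $\hat{\boldsymbol{c}}=\hat{\boldsymbol{m}}\boldsymbol{G}_1+\hat{\boldsymbol{z}}\boldsymbol{H}$ for some $\hat{\boldsymbol{z}}\in\mathbb{F}_q^{2\kappa}$. Then the encoder always succeeds (such a $\boldsymbol{z}$ always exists), and the scheme is an $(n,q^{n-r-2\kappa})_q$ $(u,t)$-PDMC.
   Context: Vectors are row vectors indexed by $\{0,\dots,n-1\}$. All arithmetic is in the finite field $\mathbb{F}_q$; the element written $q-1$ in the level notation is $-1\in\mathbb{F}_q$. An $[n,k,d]_q$ code is a $k$-dimensional linear subspace of $\mathbb{F}_q^n$ with minimum Hamming distance $d$. Block staircase form: a $2\kappa\times u$ matrix $\boldsymbol{A}$ over $\mathbb{F}_q$ has block staircase form with block lengths at most $L$ if its columns can be partitioned into $2\kappa$ consecutive nonempty intervals $B_0,\dots,B_{2\kappa-1}$ (in this order from left to right), each of size at most $L$, such that for every $i$: the entry of row $i$ in the first column of $B_i$ is $1$; the entries of row $i$ in the other columns of $B_i$ are all nonzero; and the entries of row $i$ in all columns of $B_0,\dots,B_{i-1}$ are $0$ (entries of row $i$ in columns of $B_{i+1},\dots,B_{2\kappa-1}$ are arbitrary). A cell is partially defective at level $1$ if it can store every value of $\mathbb{F}_q$ except $0$. Admissible error vectors are $\boldsymbol{e}\in\{0,1\}^n\subseteq\mathbb{F}_q^n$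 of Hamming weight at most $t$; errors may occur at any position, including the partially defective positions. An $(n,M)_q$ $(u,t)$-PDMC (code for partially defective memory cells) is a pair (encoder $\mathcal{E}$, decoder $\mathcal{D}$) with a message set $\mathcal{M}$ of size $M$ such that: $\mathcal{E}$ takes a set $\phi\subseteq\{0,\dots,n-1\}$ of $u$ positions (cells partially defective at level $1$) and a message $\boldsymbol{m}\in\mathcal{M}$, and outputs $\boldsymbol{c}\in\mathbb{F}_q^n$ such that for every admissible error vector $\boldsymbol{e}$ one has $c_i+e_i\neq 0$ for all $i\in\phi$; and $\mathcal{D}$, which is given only $\boldsymbol{c}+\boldsymbol{e}$ (not $\phi$), returns $\boldsymbol{m}$ for every admissible $\boldsymbol{e}$. *)

theory Defs
  imports Jordan_Normal_Form.DL_Rank_Submatrix "HOL-Library.Cardinality"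
begin

text \<open>
  Throughout, \<open>F\<^sub>q\<close> is an arbitrary type \<open>'a\<close> of classes \<open>field\<close> and \<open>finite\<close> with
  \<open>CARD('a) = q\<close>; hence \<open>q\<close> is a prime power, and the alphabet size is not repeated as a
  parameter of the notions below.
\<close>


section \<open>Row vectors and matrices\<close>

text \<open>The library only has matrix times column vector; \<open>v\<close> is read as a row vector here.\<close>

abbreviation vec_mult_mat :: "'a::comm_semiring_0 vec \<Rightarrow> 'a mat \<Rightarrow> 'a vec" (infixl "\<^sub>v*" 70) where
  "v \<^sub>v* A \<equiv> transpose_mat A *\<^sub>v v"

definition append_cols :: "'a::zero mat \<Rightarrow> 'a mat \<Rightarrow> 'a mat" (infixr "@\<^sub>c" 65) where
  "A @\<^sub>c B = four_block_mat A B (0\<^sub>m 0 (dim_col A)) (0\<^sub>m 0 (dim_col B))"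

text \<open>
  Block staircase form with block lengths at most \<open>L\<close>: the \<open>i\<close>-th block of columns is
  \<open>{s i..<s (Suc i)}\<close>, with one block for each row. Entries of row \<open>i\<close> to the right of its
  block are unconstrained.
\<close>

definition block_staircase :: "nat \<Rightarrow> 'a::field mat \<Rightarrow> bool" where
  "block_staircase L A \<longleftrightarrow>
    (\<exists>s :: nat \<Rightarrow> nat. s 0 = 0 \<and> s (dim_row A) = dim_col A \<and>
      (\<forall>i < dim_row A.
         s i < s (Suc i) \<and> s (Suc i) - s i \<le> L \<and>
         A $$ (i, s i) = 1 \<and>
         (\<forall>j \<in> {s i<..<s (Suc i)}. A $$ (i, j) \<noteq> 0) \<and>
         (\<forall>j < s i. A $$ (i, j) = 0)))"


section \<open>Linear codes\<close>

definition hamming_weight :: "'a::zero vec \<Rightarrow> nat" where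
  "hamming_weight v = card {i. i < dim_vec v \<and> v $ i \<noteq> 0}"

definition hamming_dist :: "'a vec \<Rightarrow> 'a vec \<Rightarrow> nat" where
  "hamming_dist x y = card {i. i < dim_vec x \<and> x $ i \<noteq> y $ i}"

definition min_dist :: "'a vec set \<Rightarrow> nat" where
  "min_dist C = Inf {hamming_dist x y | x y. x \<in> C \<and> y \<in> C \<and> x \<noteq> y}"

definition linear_code :: "nat \<Rightarrow> nat \<Rightarrow> nat \<Rightarrow> 'a::field vec set \<Rightarrow> bool" where
  "linear_code n k d C \<longleftrightarrow>
    VectorSpace.subspace class_ring C (module_vec TYPE('a) n) \<and>
    vectorspace.dim class_ring ((module_vec TYPE('a) n)\<lparr>carrier := C\<rparr>) = k \<and>
    min_dist C = d"

text \<open>The rows of \<open>G\<close> form a basis of \<open>C\<close>.\<close>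

definition generator_matrix :: "nat \<Rightarrow> nat \<Rightarrow> 'a::field vec set \<Rightarrow> 'a mat \<Rightarrow> bool" where
  "generator_matrix n k C G \<longleftrightarrow>
    G \<in> carrier_mat k n \<and>
    distinct (rows G) \<and>
    \<not> module.lin_dep class_ring (module_vec TYPE('a) n) (set (rows G)) \<and>
    vec_space.row_space n G = C"

text \<open>Ties are possible: a word may have several nearest codewords.\<close>

definition nearest_codeword :: "'a vec set \<Rightarrow> 'a vec \<Rightarrow> 'a vec \<Rightarrow> bool" where
  "nearest_codeword C y c \<longleftrightarrow> c \<in> C \<and> (\<forall>c' \<in> C. hamming_dist y c \<le> hamming_dist y c')"


section \<open>Codes for partially defective memory cells\<close>

definition admissible_error :: "nat \<Rightarrow> nat \<Rightarrow> 'a::zero_neq_one vec \<Rightarrow> bool" where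
  "admissible_error n t e \<longleftrightarrow>
    e \<in> carrier_vec n \<and> (\<forall>i < n. e $ i \<in> {0, 1}) \<and> hamming_weight e \<le> t"

definition is_pdmc ::
  "nat \<Rightarrow> nat \<Rightarrow> nat \<Rightarrow> nat \<Rightarrow> 'm set \<Rightarrow> (nat set \<Rightarrow> 'm \<Rightarrow> 'a::field vec) \<Rightarrow> ('a vec \<Rightarrow> 'm) \<Rightarrow> bool"
where
  "is_pdmc n M u t Msg enc dec \<longleftrightarrow>
    finite Msg \<and> card Msg = M \<and>
    (\<forall>\<phi> m. \<phi> \<subseteq> {..<n} \<and> card \<phi> = u \<and> m \<in> Msg \<longrightarrow>
       enc \<phi> m \<in> carrier_vec n \<and>
       (\<forall>e. admissible_error n t e \<longrightarrow>
          (\<forall>i \<in> \<phi>. (enc \<phi> m + e) $ i \<noteq> 0) \<and>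
          dec (enc \<phi> m + e) = m))"


section \<open>The coding scheme\<close>

text \<open>
  The encoder may use any suitable masking vector \<open>z\<close> and the decoder any nearest codeword,
  so the scheme is described by predicates satisfied by all its possible implementations.
\<close>

definition masks :: "'a::field mat \<Rightarrow> 'a mat \<Rightarrow> nat set \<Rightarrow> 'a vec \<Rightarrow> 'a vec \<Rightarrow> bool" where
  "masks G1 H \<phi> m z \<longleftrightarrow>
    z \<in> carrier_vec (dim_row H) \<and> (\<forall>i \<in> \<phi>. (m \<^sub>v* G1 + z \<^sub>v* H) $ i \<in> UNIV - {0, - 1})"

definition scheme_encoder ::
  "nat \<Rightarrow> nat \<Rightarrow> 'a::field mat \<Rightarrow> 'a mat \<Rightarrow> (nat set \<Rightarrow> 'a vec \<Rightarrow> 'a vec) \<Rightarrow> bool"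
where
  "scheme_encoder n u G1 H enc \<longleftrightarrow>
    (\<forall>\<phi> m. \<phi> \<subseteq> {..<n} \<and> card \<phi> = u \<and> m \<in> carrier_vec (dim_row G1) \<longrightarrow>
       (\<exists>z. masks G1 H \<phi> m z \<and> enc \<phi> m = m \<^sub>v* G1 + z \<^sub>v* H))"

definition message_of :: "'a::field mat \<Rightarrow> 'a mat \<Rightarrow> 'a vec \<Rightarrow> 'a vec \<Rightarrow> bool" where
  "message_of G1 H c m \<longleftrightarrow>
    m \<in> carrier_vec (dim_row G1) \<and> (\<exists>z \<in> carrier_vec (dim_row H). c = m \<^sub>v* G1 + z \<^sub>v* H)"

definition scheme_decoder ::
  "nat \<Rightarrow> 'a::field vec set \<Rightarrow> 'a mat \<Rightarrow> 'a mat \<Rightarrow> ('a vec \<Rightarrow> 'a vec) \<Rightarrow> bool"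
where
  "scheme_decoder n C G1 H dec \<longleftrightarrow>
    (\<forall>y \<in> carrier_vec n. \<exists>c. nearest_codeword C y c \<and> message_of G1 H c (dec y))"

end

theory Submission
  imports Defs Berlekamp_Zassenhaus.Berlekamp_Type_Based
begin

text \<open>
  The masking vector is found for the reduced row echelon form \<open>A\<close> of the columns of \<open>H\<close> at the
  defective positions, which has the same row space as those columns. In block staircase form,
  the coordinate \<open>i\<close> of \<open>z\<close> does not influence the blocks to the left of block \<open>i\<close>, so the
  coordinates can be chosen greedily: each of the at most \<open>(q - 1) div 2\<close> columns of block \<open>i\<close>
  excludes two values, so fewer than \<open>q\<close> values are excluded. Avoiding \<open>- 1\<close> in addition to \<open>0\<close>
  makes the defective cells robust against an additive error \<open>1\<close>. Decoding is bounded distance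
  decoding in \<open>C\<close>, followed by reading off the coordinates in the basis given by the rows of \<open>G\<close>.
\<close>

section \<open>Row vector products with stacked matrices and with selected columns\<close>

lemma vec_mult_mat_index:
  assumes "A \<in> carrier_mat m n" "z \<in> carrier_vec m" "j < n"
  shows "(z \<^sub>v* A) $ j = (\<Sum>i<m. z $ i * A $$ (i, j))"
  using assms by (auto simp: scalar_prod_def lessThan_atLeast0 mult.commute intro!: sum.cong)

lemma vec_mult_mat_append:
  fixes A B :: "'a::comm_semiring_0 mat"
  assumes A: "A \<in> carrier_mat m1 n" and B: "B \<in> carrier_mat m2 n"
    and y: "y \<in> carrier_vec m1" and z: "z \<in> carrier_vec m2"
  shows "(y @\<^sub>v z) \<^sub>v* (A @\<^sub>r B) = y \<^sub>v* A + z \<^sub>v* B"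
proof (rule eq_vecI)
  have AB: "A @\<^sub>r B \<in> carrier_mat (m1 + m2) n" using A B by auto
  have yz: "y @\<^sub>v z \<in> carrier_vec (m1 + m2)" using y z by auto
  fix j assume "j < dim_vec (y \<^sub>v* A + z \<^sub>v* B)"
  hence j: "j < n" using B by auto
  have "(\<Sum>i<m1 + m2. (y @\<^sub>v z) $ i * (A @\<^sub>r B) $$ (i, j))
      = (\<Sum>i<m1. (y @\<^sub>v z) $ i * (A @\<^sub>r B) $$ (i, j))
        + (\<Sum>i<m2. (y @\<^sub>v z) $ (m1 + i) * (A @\<^sub>r B) $$ (m1 + i, j))"
    by (induction m2) (simp_all add: add.assoc)
  also have "\<dots> = (\<Sum>i<m1. y $ i * A $$ (i, j)) + (\<Sum>i<m2. z $ i * B $$ (i, j))"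
    using A B y z j by (auto simp: append_rows_def intro!: arg_cong2[of _ _ _ _ "(+)"] sum.cong)
  finally show "((y @\<^sub>v z) \<^sub>v* (A @\<^sub>r B)) $ j = (y \<^sub>v* A + z \<^sub>v* B) $ j"
    using A B j by (simp add: vec_mult_mat_index[OF AB yz j] vec_mult_mat_index[OF A y j]
        vec_mult_mat_index[OF B z j] del: index_mult_mat_vec)
qed (use A B in \<open>auto simp: append_rows_def\<close>)

text \<open>Selected columns are renumbered in increasing order, so the new index of
  \<open>j\<close> counts the smaller elements of \<open>J\<close>; \<open>pick J\<close> inverts
  this count.\<close>

lemma vec_mult_mat_submatrix:
  assumes H: "H \<in> carrier_mat m n" and z: "z \<in> carrier_vec m"
    and J: "J \<subseteq> {..<n}" and j: "j \<in> J"
  shows "(z \<^sub>v* submatrix H UNIV J) $ card {a \<in> J. a < j} = (z \<^sub>v* H) $ j"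
proof -
  have [simp]: "{x. x < n \<and> x \<in> J} = J" using J by auto
  have S: "submatrix H UNIV J \<in> carrier_mat m (card J)"
    using H by (auto simp: dim_submatrix)
  have "finite J" using J finite_subset by blast
  hence c: "card {a \<in> J. a < j} < card J" using j by (auto intro!: psubset_card_mono)
  have "submatrix H UNIV J $$ (i, card {a \<in> J. a < j}) = H $$ (i, j)" if "i < m" for i
    using submatrix_index_card[of i H j UNIV J] that H J j by auto
  thus ?thesis
    using j J by (auto simp: vec_mult_mat_index[OF S z c] vec_mult_mat_index[OF H z]
        simp del: index_mult_mat_vec)
qed

section \<open>Greedy avoidance of forbidden values\<close>

text \<open>The forbidden sets \<open>F j\<close> vary with the column because the message will
  shift the values to be avoided differently in each cell; only their size bound \<open>b\<close>
  enters the count.\<close>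

lemma block_staircase_avoid:
  fixes A :: "'a::{field,finite} mat" and F :: "nat \<Rightarrow> 'a set"
  assumes A: "A \<in> carrier_mat m n" and st: "block_staircase L A"
    and F: "\<And>j. j < n \<Longrightarrow> card (F j) \<le> b" and L: "L * b < CARD('a)"
  obtains z where "z \<in> carrier_vec m" "\<And>j. j < n \<Longrightarrow> (z \<^sub>v* A) $ j \<notin> F j"
proof -
  obtain s :: "nat \<Rightarrow> nat" where s0: "s 0 = 0" and sm: "s m = n"
    and step: "\<And>i. i < m \<Longrightarrow> s i < s (Suc i)" and len: "\<And>i. i < m \<Longrightarrow> s (Suc i) - s i \<le> L"
    and one: "\<And>i. i < m \<Longrightarrow> A $$ (i, s i) = 1"
    and nz: "\<And>i j. i < m \<Longrightarrow> j \<in> {s i<..<s (Suc i)} \<Longrightarrow> A $$ (i, j) \<noteq> 0"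
    and z0: "\<And>i j. i < m \<Longrightarrow> j < s i \<Longrightarrow> A $$ (i, j) = 0"
    using st A unfolding block_staircase_def by auto
  have mono: "s i \<le> s l" if "i \<le> l" "l \<le> m" for i l
    using that
  proof (induction l rule: dec_induct)
    case (step l)
    thus ?case using \<open>\<And>i. i < m \<Longrightarrow> s i < s (Suc i)\<close>[of l] by simp
  qed simp
  \<comment> \<open>Greedy invariant: the first \<open>l\<close> coordinates settle the columns of
    the first \<open>l\<close> blocks for good. Taking \<open>x\<close> as a function lets the next
    coordinate be set by a function update; \<open>l = m\<close> reaches all \<open>n\<close>
    columns.\<close>
  have "\<exists>x :: nat \<Rightarrow> 'a. \<forall>j < s l. (\<Sum>i<l. x i * A $$ (i, j)) \<notin> F j" if "l \<le> m" for l
    using that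
  proof (induction l)
    case 0
    thus ?case by (simp add: s0)
  next
    case (Suc l)
    then obtain x :: "nat \<Rightarrow> 'a" where x: "\<And>j. j < s l \<Longrightarrow> (\<Sum>i<l. x i * A $$ (i, j)) \<notin> F j"
      by auto
    have l: "l < m" using Suc.prems by simp
    define g where "g j = (\<Sum>i<l. x i * A $$ (i, j))" for j
    \<comment> \<open>The solutions \<open>v\<close> of \<open>g j + v * A $$ (l, j) = y\<close> for
      \<open>y\<close> in \<open>F j\<close> and \<open>j\<close> in block \<open>l\<close>. The
      divisor is nonzero on the block, so each forbidden \<open>y\<close> costs one value of
      \<open>v\<close>.\<close>
    define bad where "bad = (\<Union>j\<in>{s l..<s (Suc l)}. (\<lambda>y. (y - g j) / A $$ (l, j)) ` F j)"
    have "card bad \<le> (\<Sum>j\<in>{s l..<s (Suc l)}. card ((\<lambda>y. (y - g j) / A $$ (l, j)) ` F j))"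
      unfolding bad_def by (rule card_UN_le) simp
    also have "\<dots> \<le> (\<Sum>j\<in>{s l..<s (Suc l)}. b)"
    proof (rule sum_mono)
      fix j assume "j \<in> {s l..<s (Suc l)}"
      hence "j < n" using mono[of "Suc l" m] Suc.prems sm by auto
      thus "card ((\<lambda>y. (y - g j) / A $$ (l, j)) ` F j) \<le> b"
        using card_image_le[of "F j" "\<lambda>y. (y - g j) / A $$ (l, j)"] F[of j] by (meson finite le_trans)
    qed
    also have "\<dots> \<le> L * b" using len[OF l] by simp
    finally have "card bad < CARD('a)" using L by simp
    then obtain v where v: "v \<notin> bad" by (metis UNIV_eq_I less_irrefl)
    \<comment> \<open>Left of block \<open>l\<close> the new row is zero and the earlier choice
      survives; inside the block, hitting \<open>F j\<close> would put \<open>v\<close> into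
      \<open>bad\<close>.\<close>
    have "g j + v * A $$ (l, j) \<notin> F j" if j: "j < s (Suc l)" for j
    proof (cases "j < s l")
      case True
      thus ?thesis using x[of j] z0[OF l True] by (simp add: g_def)
    next
      case False
      hence "A $$ (l, j) \<noteq> 0" using one[OF l] nz[OF l, of j] j by (cases "j = s l") auto
      hence v_eq: "v = (g j + v * A $$ (l, j) - g j) / A $$ (l, j)" by simp
      show ?thesis
      proof
        assume "g j + v * A $$ (l, j) \<in> F j"
        hence "v \<in> (\<lambda>y. (y - g j) / A $$ (l, j)) ` F j" using v_eq by (rule rev_image_eqI)
        hence "v \<in> bad" using False j unfolding bad_def by auto
        thus False using v by simp
      qed
    qed
    thus ?case by (intro exI[of _ "x(l := v)"]) (simp add: g_def)
  qed
  then obtain x :: "nat \<Rightarrow> 'a" where x: "\<And>j. j < n \<Longrightarrow> (\<Sum>i<m. x i * A $$ (i, j)) \<notin> F j"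
    using sm by blast
  show ?thesis
  proof (rule that)
    show z: "vec m x \<in> carrier_vec m" by simp
    show "(vec m x \<^sub>v* A) $ j \<notin> F j" if "j < n" for j
      unfolding vec_mult_mat_index[OF A z that] using x[OF that] by simp
  qed
qed

text \<open>Row reduction is left multiplication by some \<open>Q\<close>, so a row vector
  \<open>y\<close> solving the problem for the reduced columns yields the solution
  \<open>y \<^sub>v* Q\<close> for the original ones.\<close>

lemma gauss_jordan_staircase_avoid:
  fixes H :: "'a::{field,finite} mat" and F :: "nat \<Rightarrow> 'a set"
  assumes H: "H \<in> carrier_mat m n" and J: "J \<subseteq> {..<n}"
    and st: "block_staircase L (gauss_jordan_single (submatrix H UNIV J))"
    and F: "\<And>j. j \<in> J \<Longrightarrow> card (F j) \<le> b" and L: "L * b < CARD('a)"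
  obtains z where "z \<in> carrier_vec m" "\<And>j. j \<in> J \<Longrightarrow> (z \<^sub>v* H) $ j \<notin> F j"
proof -
  let ?S = "submatrix H UNIV J" and ?A = "gauss_jordan_single (submatrix H UNIV J)"
  have fin: "finite J" using J finite_subset by blast
  have [simp]: "{x. x < n \<and> x \<in> J} = J" using J by auto
  have S: "?S \<in> carrier_mat m (card J)"
    using H by (auto simp: dim_submatrix)
  have A: "?A \<in> carrier_mat m (card J)" using gauss_jordan_single(2)[OF S refl] .
  obtain Q where Q: "Q \<in> carrier_mat m m" and AQ: "?A = Q * ?S"
    using gauss_jordan_single(4)[OF S refl] by blast
  \<comment> \<open>Column \<open>j\<close> of the reduced matrix stands for position
    \<open>pick J j\<close>, so the forbidden sets are reindexed along \<open>pick\<close>.\<close>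
  have "card (F (pick J j)) \<le> b" if "j < card J" for j
    using F pick_in_set_le[OF that] by simp
  then obtain y where y: "y \<in> carrier_vec m"
    and avoid: "\<And>j. j < card J \<Longrightarrow> (y \<^sub>v* ?A) $ j \<notin> F (pick J j)"
    using block_staircase_avoid[OF A st _ L, of "\<lambda>j. F (pick J j)"] by blast
  define z where "z = y \<^sub>v* Q"
  have z: "z \<in> carrier_vec m" using Q y by (auto simp: z_def)
  have eq: "z \<^sub>v* ?S = y \<^sub>v* ?A"
    unfolding AQ z_def transpose_mult[OF Q S] using Q S y
    by (intro assoc_mult_mat_vec[symmetric]) auto
  have "(z \<^sub>v* H) $ j \<notin> F j" if j: "j \<in> J" for j
  proof -
    have "card {a \<in> J. a < j} < card J" using fin j by (auto intro!: psubset_card_mono)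
    from avoid[OF this] show ?thesis
      using vec_mult_mat_submatrix[OF H z J j] by (simp only: eq pick_card_in_set[OF j] not_False_eq_True)
  qed
  with z show ?thesis by (rule that)
qed

section \<open>Hamming distance and decoding to the nearest codeword\<close>

lemma hamming_dist_commute:
  "dim_vec x = dim_vec y \<Longrightarrow> hamming_dist x y = hamming_dist y x"
  by (auto simp: hamming_dist_def intro!: arg_cong[of _ _ card])

lemma hamming_dist_triangle:
  assumes "dim_vec x = dim_vec y"
  shows "hamming_dist x z \<le> hamming_dist x y + hamming_dist y z"
proof -
  have "hamming_dist x z \<le> card ({i. i < dim_vec x \<and> x $ i \<noteq> y $ i} \<union> {i. i < dim_vec y \<and> y $ i \<noteq> z $ i})"
    unfolding hamming_dist_def using assms by (intro card_mono) auto
  also have "\<dots> \<le> hamming_dist x y + hamming_dist y z"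
    unfolding hamming_dist_def by (rule card_Un_le)
  finally show ?thesis .
qed

lemma hamming_dist_add_error:
  fixes c e :: "'a::ab_group_add vec"
  assumes "c \<in> carrier_vec n" "e \<in> carrier_vec n"
  shows "hamming_dist (c + e) c = hamming_weight e"
  using assms by (auto simp: hamming_dist_def hamming_weight_def intro!: arg_cong[of _ _ card])

lemma min_dist_le:
  "x \<in> C \<Longrightarrow> y \<in> C \<Longrightarrow> x \<noteq> y \<Longrightarrow> min_dist C \<le> hamming_dist x y"
  unfolding min_dist_def by (rule cInf_lower) auto

text \<open>Both \<open>c\<close> and any nearest codeword lie within distance \<open>t\<close> of
  the received word, hence within \<open>2 * t\<close> of each other. So no tie can occur after an
  admissible error.\<close>

lemma nearest_codeword_unique:
  fixes C :: "'a::ab_group_add vec set"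
  assumes C: "C \<subseteq> carrier_vec n" and d: "2 * t < min_dist C"
    and c: "c \<in> C" and e: "e \<in> carrier_vec n" "hamming_weight e \<le> t"
    and near: "nearest_codeword C (c + e) c'"
  shows "c' = c"
proof (rule ccontr)
  assume ne: "c' \<noteq> c"
  have c': "c' \<in> C" and le: "hamming_dist (c + e) c' \<le> hamming_dist (c + e) c"
    using near c by (auto simp: nearest_codeword_def)
  have dims: "c \<in> carrier_vec n" "c' \<in> carrier_vec n" using C c c' by auto
  have "min_dist C \<le> hamming_dist c' c" by (rule min_dist_le[OF c' c ne])
  also have "\<dots> \<le> hamming_dist c' (c + e) + hamming_dist (c + e) c"
    using dims e by (intro hamming_dist_triangle) auto
  also have "\<dots> \<le> 2 * t"
    using le dims e hamming_dist_commute[of c' "c + e"] hamming_dist_add_error[OF dims(1) e(1)]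
    by auto
  finally show False using d by simp
qed

text \<open>Distances are natural numbers, so the least one is attained.\<close>

lemma nearest_codeword_exists:
  assumes "C \<noteq> {}"
  shows "\<exists>c. nearest_codeword C y c"
proof -
  obtain c0 where "c0 \<in> C" using assms by blast
  from ex_has_least_nat[of "\<lambda>c. c \<in> C", OF this] show ?thesis
    unfolding nearest_codeword_def by blast
qed

section \<open>Coordinates with respect to the generator matrix\<close>

lemma generator_matrix_codeword_iff:
  fixes G :: "'a::field mat"
  assumes "generator_matrix n k C G"
  shows "c \<in> C \<longleftrightarrow> (\<exists>y \<in> carrier_vec k. c = y \<^sub>v* G)"
  using assms unfolding generator_matrix_def by (auto simp: vec_space.row_space_eq)

text \<open>A nonzero \<open>y - z\<close> would be a nontrivial relation among the rows of
  \<open>G\<close>. As the rows are distinct, this is a linear dependence of the set of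
  rows.\<close>

lemma generator_matrix_inj:
  fixes G :: "'a::field mat"
  assumes gen: "generator_matrix n k C G"
    and y: "y \<in> carrier_vec k" and z: "z \<in> carrier_vec k" and eq: "y \<^sub>v* G = z \<^sub>v* G"
  shows "y = z"
proof (rule ccontr)
  assume ne: "y \<noteq> z"
  have G: "G\<^sup>T \<in> carrier_mat n k" using gen by (auto simp: generator_matrix_def)
  have "y - z \<noteq> 0\<^sub>v k"
  proof
    assume 0: "y - z = 0\<^sub>v k"
    have "y = z"
    proof (rule eq_vecI)
      fix i assume "i < dim_vec z"
      with z have "i < k" by simp
      with arg_cong[OF 0, of "\<lambda>v. v $ i"] y z show "y $ i = z $ i" by simp
    qed (use y z in simp)
    with ne show False ..
  qed
  moreover have "G\<^sup>T *\<^sub>v (y - z) = 0\<^sub>v n"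
    using mult_minus_distrib_mat_vec[OF G y z] eq G z by (auto simp: minus_cancel_vec[of _ n])
  ultimately have "module.lin_dep class_ring (module_vec TYPE('a) n) (set (cols G\<^sup>T))"
    using gen y z by (intro vec_space.lin_depI[OF G]) (auto simp: generator_matrix_def)
  thus False using gen by (simp add: generator_matrix_def)
qed

text \<open>Makes the last step of the decoder well defined: the message consists of the first
  \<open>k1\<close> coordinates of \<open>c\<close> in the basis of rows, the masking vector of the
  remaining \<open>k2\<close>.\<close>

lemma ex1_message_of:
  fixes G1 H :: "'a::field mat"
  assumes gen: "generator_matrix n (k1 + k2) C (G1 @\<^sub>r H)"
    and G1: "G1 \<in> carrier_mat k1 n" and H: "H \<in> carrier_mat k2 n" and c: "c \<in> C"
  shows "\<exists>!m. message_of G1 H c m"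
proof -
  obtain y where y: "y \<in> carrier_vec (k1 + k2)" and cy: "c = y \<^sub>v* (G1 @\<^sub>r H)"
    using generator_matrix_codeword_iff[OF gen] c by blast
  have "message_of G1 H c (vec_first y k1)"
    unfolding message_of_def using y cy G1 H
    by (auto intro!: bexI[of _ "vec_last y k2"] simp: vec_mult_mat_append[symmetric])
  moreover have "m = m'" if "message_of G1 H c m" "message_of G1 H c m'" for m m'
  proof -
    obtain z z' where z: "m \<in> carrier_vec k1" "z \<in> carrier_vec k2" "c = m \<^sub>v* G1 + z \<^sub>v* H"
      and z': "m' \<in> carrier_vec k1" "z' \<in> carrier_vec k2" "c = m' \<^sub>v* G1 + z' \<^sub>v* H"
      using \<open>message_of G1 H c m\<close> \<open>message_of G1 H c m'\<close> G1 H unfolding message_of_def by auto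
    have "(m @\<^sub>v z) \<^sub>v* (G1 @\<^sub>r H) = (m' @\<^sub>v z') \<^sub>v* (G1 @\<^sub>r H)"
      unfolding vec_mult_mat_append[OF G1 H z(1,2)] vec_mult_mat_append[OF G1 H z'(1,2)]
      by (rule trans[OF z(3)[symmetric] z'(3)])
    hence "m @\<^sub>v z = m' @\<^sub>v z'"
      by (rule generator_matrix_inj[OF gen append_carrier_vec[OF z(1,2)] append_carrier_vec[OF z'(1,2)]])
    thus "m = m'" using append_vec_eq[OF z(1) z'(1)] by simp
  qed
  ultimately show ?thesis by blast
qed

text \<open>Masking only adds combinations of rows of \<open>H\<close>, so the encoder never leaves
  the code.\<close>

lemma message_of_imp_codeword:
  fixes G1 H :: "'a::field mat"
  assumes gen: "generator_matrix n (k1 + k2) C (G1 @\<^sub>r H)"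
    and G1: "G1 \<in> carrier_mat k1 n" and H: "H \<in> carrier_mat k2 n"
    and "message_of G1 H c m"
  shows "c \<in> C"
proof -
  obtain z where "m \<in> carrier_vec k1" "z \<in> carrier_vec k2" "c = m \<^sub>v* G1 + z \<^sub>v* H"
    using assms(4) G1 H unfolding message_of_def by auto
  thus ?thesis
    unfolding generator_matrix_codeword_iff[OF gen]
    by (intro bexI[of _ "m @\<^sub>v z"]) (simp_all add: vec_mult_mat_append[OF G1 H])
qed

section \<open>Existence of masking vectors\<close>

lemma card_two_le: "card {a, b} \<le> 2"
  by (simp add: card_insert_if)

lemma masks_exists:
  fixes G1 H :: "'a::{field,finite} mat"
  assumes H: "H \<in> carrier_mat m n" and G1: "G1 \<in> carrier_mat k n"
    and \<phi>: "\<phi> \<subseteq> {..<n}"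
    and st: "block_staircase ((CARD('a) - 1) div 2) (gauss_jordan_single (submatrix H UNIV \<phi>))"
  shows "\<exists>z. masks G1 H \<phi> x z"
proof -
  define w where "w = x \<^sub>v* G1"
  \<comment> \<open>The counting condition \<open>L * b < CARD('a)\<close> with
    \<open>b = 2\<close>: after subtracting \<open>w $ j\<close>, the values \<open>0\<close> and
    \<open>- 1\<close> become the two forbidden values of
    \<open>(z \<^sub>v* H) $ j\<close>.\<close>
  have "(CARD('a) - 1) div 2 * 2 < CARD('a)" using zero_less_card_finite[where 'a = 'a] by linarith
  then obtain z where z: "z \<in> carrier_vec m"
    and avoid: "\<And>j. j \<in> \<phi> \<Longrightarrow> (z \<^sub>v* H) $ j \<notin> {- w $ j, - 1 - w $ j}"
    using gauss_jordan_staircase_avoid[OF H \<phi> st, of "\<lambda>j. {- w $ j, - 1 - w $ j}" 2]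
    by (metis card_two_le)
  have "(w + z \<^sub>v* H) $ j \<in> UNIV - {0, - 1}" if j: "j \<in> \<phi>" for j
  proof -
    have "j < n" using \<phi> j by auto
    hence "(w + z \<^sub>v* H) $ j = w $ j + (z \<^sub>v* H) $ j" using H by simp
    thus ?thesis using avoid[OF j] by (auto simp: algebra_simps eq_neg_iff_add_eq_0 simp del: index_mult_mat_vec)
  qed
  thus ?thesis using z H unfolding masks_def w_def by auto
qed

section \<open>Correctness of the coding scheme\<close>

text \<open>The existence clauses for encoder and decoder ensure that the final claim about all
  implementations is not vacuous.\<close>

theorem theorem3:
  fixes q n \<kappa> r t u k d :: nat
    and H P G1 G :: "'a::{field,finite} mat"
    and C :: "'a vec set"
  assumes "CARD('a) = q"
    and "n \<ge> 1" and "\<kappa> \<ge> 1" and "n - r - 2 * \<kappa> \<ge> 1" and "u \<le> n"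
    and "H \<in> carrier_mat (2 * \<kappa>) n"
    and "\<And>J. J \<subseteq> {..<n} \<Longrightarrow> card J = u \<Longrightarrow>
           block_staircase ((q - 1) div 2) (gauss_jordan_single (submatrix H UNIV J))"
    and "k = n - r" and "d \<ge> 2 * t + 1"
    and "linear_code n k d C"
    and "P \<in> carrier_mat (n - r - 2 * \<kappa>) r"
    and "G1 = 0\<^sub>m (n - r - 2 * \<kappa>) (2 * \<kappa>) @\<^sub>c 1\<^sub>m (n - r - 2 * \<kappa>) @\<^sub>c P"
    and "G = G1 @\<^sub>r H"
    and "generator_matrix n k C G"
  shows "(\<forall>\<phi> m. \<phi> \<subseteq> {..<n} \<and> card \<phi> = u \<and> m \<in> carrier_vec (n - r - 2 * \<kappa>) \<longrightarrow>
            (\<exists>z. masks G1 H \<phi> m z))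
       \<and> (\<forall>c \<in> C. \<exists>!m. message_of G1 H c m)
       \<and> (\<exists>enc. scheme_encoder n u G1 H enc)
       \<and> (\<exists>dec. scheme_decoder n C G1 H dec)
       \<and> (\<forall>enc dec. scheme_encoder n u G1 H enc \<and> scheme_decoder n C G1 H dec \<longrightarrow>
            is_pdmc n (q ^ (n - r - 2 * \<kappa>)) u t (carrier_vec (n - r - 2 * \<kappa>)) enc dec)"
proof -
  \<comment> \<open>Truncated subtraction is harmless here: a positive difference forces
    \<open>r + 2 * \<kappa> < n\<close>.\<close>
  have dim: "r + 2 * \<kappa> < n" using assms(4) by simp
  define K where "K = n - r - 2 * \<kappa>"
  have nK: "n = 2 * \<kappa> + (K + r)" and kK: "k = K + 2 * \<kappa>"
    using dim assms(8) by (auto simp: K_def)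
  have G1: "G1 \<in> carrier_mat K n"
    using assms(11) unfolding assms(12) append_cols_def nK K_def[symmetric] by (auto simp: four_block_mat_def Let_def)
  note H = assms(6)
  have gen: "generator_matrix n (K + 2 * \<kappa>) C (G1 @\<^sub>r H)"
    using assms(13,14) kK by simp
  have C: "C \<subseteq> carrier_vec n"
    using generator_matrix_codeword_iff[OF gen] carrier_append_rows[OF G1 H] by auto
  have C_ne: "C \<noteq> {}"
    using generator_matrix_codeword_iff[OF gen] zero_carrier_vec by blast
  have d: "2 * t < min_dist C" using assms(9,10) by (auto simp: linear_code_def)
  have mask: "\<exists>z. masks G1 H \<phi> m z" if "\<phi> \<subseteq> {..<n}" "card \<phi> = u" for \<phi> m
    using masks_exists[OF H G1 that(1)] assms(7)[OF that] assms(1) by simp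
  have msg: "\<exists>!m. message_of G1 H c m" if "c \<in> C" for c
    using ex1_message_of[OF gen G1 H that] .
  have enc: "\<exists>enc. scheme_encoder n u G1 H enc"
    unfolding scheme_encoder_def
    by (rule exI[of _ "\<lambda>\<phi> m. m \<^sub>v* G1 + (SOME z. masks G1 H \<phi> m z) \<^sub>v* H"])
      (metis mask someI_ex)
  \<comment> \<open>Ties far from the code are broken by choice; every word needs some output, since
    the decoder is total on \<open>carrier_vec n\<close>.\<close>
  have "\<exists>m c. nearest_codeword C y c \<and> message_of G1 H c m" for y
    using nearest_codeword_exists[OF C_ne, of y] msg unfolding nearest_codeword_def by blast
  then obtain dec where "\<And>y. \<exists>c. nearest_codeword C y c \<and> message_of G1 H c (dec y)"
    by metis
  hence dec: "\<exists>dec. scheme_decoder n C G1 H dec" unfolding scheme_decoder_def by blast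
  have "is_pdmc n (q ^ K) u t (carrier_vec K) enc dec"
    if E: "scheme_encoder n u G1 H enc" and D: "scheme_decoder n C G1 H dec" for enc dec
    unfolding is_pdmc_def
  proof (intro conjI allI impI; (elim conjE)?)
    show "finite (carrier_vec K :: 'a vec set)" by simp
    show "card (carrier_vec K :: 'a vec set) = q ^ K" using assms(1) by (simp add: card_carrier_vec)
    fix \<phi> and m :: "'a vec"
    assume \<phi>: "\<phi> \<subseteq> {..<n}" "card \<phi> = u" and m: "m \<in> carrier_vec K"
    obtain z where z: "masks G1 H \<phi> m z" and c: "enc \<phi> m = m \<^sub>v* G1 + z \<^sub>v* H"
      using E \<phi> m G1 unfolding scheme_encoder_def by (metis carrier_matD(1))
    show cn: "enc \<phi> m \<in> carrier_vec n" unfolding c using G1 H by (intro carrier_vecI) auto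
    have mc: "message_of G1 H (enc \<phi> m) m"
      unfolding message_of_def using z m G1 c by (auto simp: masks_def)
    have cC: "enc \<phi> m \<in> C" by (rule message_of_imp_codeword[OF gen G1 H mc])
    fix e :: "'a vec" assume adm: "admissible_error n t e"
    hence e: "e \<in> carrier_vec n" "hamming_weight e \<le> t" by (auto simp: admissible_error_def)
    \<comment> \<open>Error \<open>0\<close> is covered by avoiding \<open>0\<close>, error
      \<open>1\<close> by avoiding \<open>- 1\<close>.\<close>
    show "\<forall>i \<in> \<phi>. (enc \<phi> m + e) $ i \<noteq> 0"
    proof
      fix i assume i: "i \<in> \<phi>"
      hence "i < n" using \<phi> by auto
      moreover have "enc \<phi> m $ i \<notin> {0, - 1}" using z i unfolding masks_def c by auto
      moreover have "e $ i \<in> {0, 1}" using adm \<open>i < n\<close> by (simp add: admissible_error_def)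
      ultimately show "(enc \<phi> m + e) $ i \<noteq> 0"
        using e by (auto simp: eq_neg_iff_add_eq_0)
    qed
    obtain c' where near: "nearest_codeword C (enc \<phi> m + e) c'"
      and m': "message_of G1 H c' (dec (enc \<phi> m + e))"
      using D cn e unfolding scheme_decoder_def by (meson add_carrier_vec)
    \<comment> \<open>The decoder therefore reads its message off the transmitted codeword itself,
      where the message is unique.\<close>
    have "c' = enc \<phi> m" by (rule nearest_codeword_unique[OF C d cC e near])
    thus "dec (enc \<phi> m + e) = m" using m' mc msg[OF cC] by blast
  qed
  with mask msg enc dec show ?thesis unfolding K_def by blast
qed

end
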